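(* Fix $j\in\mathbb{Z}_+$ and, for each $k\in\mathbb{N}$, let $n=n_k$ be an integer with $n_k>j+k$. Let $\hat h_{j,k}=V_j^k/N_j^k$ be the estimator of the hazard rate $h_j$ computed from the first $n_k$ records of the sequence $X_1,X_2,\ldots$ and their associated near-records with parameter $k+1$. Then, as $k\to\infty$, $\hat h_{j,k}\to h_j$ almost surely and $\mathrm{MSE}(\hat h_{j,k})=\mathbb{E}\big((\hat h_{j,k}-h_j)^2\big)\to0$.
   Context: $\mathbb{Z}_+=\{0,1,2,\ldots\}$. $X_1,X_2,\ldots$ are i.i.d. random variables with values in $\mathbb{Z}_+$ and infinite support; $h_j=\mathbb{P}(X_1=j)/\mathbb{P}(X_1\ge j)$ is the hazard rate. Let $M_i=\max\{X_1,\ldots,X_i\}$; record times $L_1=1$, $L_m=\min\{i>L_{m-1}:X_i>X_{L_{m-1}}\}$; records $R_m=X_{L_m}$. For given $k$, an observation $X_i$ ($i\ge2$) is a near-record (with parameter $k+1$) if $M_{i-1}-k\le X_i\le M_{i-1}$; it is associated with $R_m$ if $L_m<i<L_{m+1}$. Let $S_i$ be the number of near-records associated with $R_i$ and $Y_i^1,\ldots,Y_i^{S_i}$ their values. For $m\in\mathbb{Z}_+$, $\ell=0,\ldots,k$, from the first $n$ records and their near-records define $A_m^0=\sum_{i=1}^n\big(\mathbf 1_{\{R_i=m\}}+\sum_{r=1}^{S_i}\mathbf 1_{\{R_i=m,\,Y_i^r=m\}}\big)$; $A_m^\ell=\sum_{i=1}^n\sum_{r=1}^{S_i}\mathbf 1_{\{R_i=m+\ell,\,Y_i^r=m\}}$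 for $\ell\ge1$; $V_m^\ell=\sum_{i=0}^\ell A_m^i$; $N_m^\ell=1+\sum_{i=0}^\ell V_{m+i}^{\ell-i}$; and $\hat h_{j,k}=V_j^k/N_j^k$. *)

theory Defs
  imports "HOL-Probability.Probability"
begin

text \<open>
  Records and near-records are defined path by path, for a sequence \<open>x\<close> of natural numbers.
  Observations \<open>x 1, x 2, \<dots>\<close> and records are indexed from 1, and \<open>x 0\<close> is never used.
\<close>

definition running_max :: "(nat \<Rightarrow> nat) \<Rightarrow> nat \<Rightarrow> nat" where
  "running_max x i = Max (x ` {1..i})"

text \<open>
  If the sequence has no further record, the record time is repeated. For i.i.d. observations with
  infinite support this only happens on a null event; the convention makes the record times depend
  on \<open>x 1, x 2, \<dots>\<close> only, so that everything below is a random variable. The value at index 0 is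
  a dummy.
\<close>

fun record_time :: "(nat \<Rightarrow> nat) \<Rightarrow> nat \<Rightarrow> nat" where
  "record_time x 0 = 1"
| "record_time x (Suc 0) = 1"
| "record_time x (Suc (Suc m)) =
     (let l = record_time x (Suc m)
      in if \<exists>i>l. x i > x l then LEAST i. i > l \<and> x i > x l else l)"

definition record_value :: "(nat \<Rightarrow> nat) \<Rightarrow> nat \<Rightarrow> nat" where
  "record_value x m = x (record_time x m)"

text \<open>
  Near-records with parameter \<open>k + 1\<close>. The lower bound is compared in the integers, as the
  difference may be negative.
\<close>

definition near_record :: "nat \<Rightarrow> (nat \<Rightarrow> nat) \<Rightarrow> nat \<Rightarrow> bool" where
  "near_record k x i \<longleftrightarrow>
     i \<ge> 2 \<and> int (running_max x (i - 1)) - int k \<le> int (x i) \<and> x i \<le> running_max x (i - 1)"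

definition near_record_times :: "nat \<Rightarrow> (nat \<Rightarrow> nat) \<Rightarrow> nat \<Rightarrow> nat set" where
  "near_record_times k x m =
     {i. record_time x m < i \<and> i < record_time x (m + 1) \<and> near_record k x i}"

definition near_record_count :: "nat \<Rightarrow> (nat \<Rightarrow> nat) \<Rightarrow> nat \<Rightarrow> nat" where
  "near_record_count k x m = card (near_record_times k x m)"

text \<open>
  The value \<open>Y\<^sub>m\<^sup>r\<close> of the \<open>r\<close>-th near-record associated with the \<open>m\<close>-th record, in order of
  occurrence, for \<open>1 \<le> r \<le> near_record_count k x m\<close>.
\<close>

definition near_record_value :: "nat \<Rightarrow> (nat \<Rightarrow> nat) \<Rightarrow> nat \<Rightarrow> nat \<Rightarrow> nat" where
  "near_record_value k x m r = x (sorted_list_of_set (near_record_times k x m) ! (r - 1))"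

text \<open>
  The statistics \<open>A\<^sub>m\<^sup>l\<close>, \<open>V\<^sub>m\<^sup>l\<close>, \<open>N\<^sub>m\<^sup>l\<close> (for \<open>l \<le> k\<close>), computed from the first \<open>n\<close> records and
  their near-records with parameter \<open>k + 1\<close>. The arguments are \<open>k n x l m\<close>, in this order.
\<close>

definition A_stat :: "nat \<Rightarrow> nat \<Rightarrow> (nat \<Rightarrow> nat) \<Rightarrow> nat \<Rightarrow> nat \<Rightarrow> nat" where
  "A_stat k n x l m =
     (if l = 0 then
        (\<Sum>i=1..n. of_bool (record_value x i = m) +
           (\<Sum>r=1..near_record_count k x i.
              of_bool (record_value x i = m \<and> near_record_value k x i r = m)))
      else
        (\<Sum>i=1..n. \<Sum>r=1..near_record_count k x i.
           of_bool (record_value x i = m + l \<and> near_record_value k x i r = m)))"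

definition V_stat :: "nat \<Rightarrow> nat \<Rightarrow> (nat \<Rightarrow> nat) \<Rightarrow> nat \<Rightarrow> nat \<Rightarrow> nat" where
  "V_stat k n x l m = (\<Sum>i=0..l. A_stat k n x i m)"

definition N_stat :: "nat \<Rightarrow> nat \<Rightarrow> (nat \<Rightarrow> nat) \<Rightarrow> nat \<Rightarrow> nat \<Rightarrow> nat" where
  "N_stat k n x l m = 1 + (\<Sum>i=0..l. V_stat k n x (l - i) (m + i))"

definition hazard_estimator :: "nat \<Rightarrow> nat \<Rightarrow> (nat \<Rightarrow> nat) \<Rightarrow> nat \<Rightarrow> real" where
  "hazard_estimator k n x j = real (V_stat k n x k j) / real (N_stat k n x k j)"

definition hazard_rate :: "'a measure \<Rightarrow> ('a \<Rightarrow> nat) \<Rightarrow> nat \<Rightarrow> real" where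
  "hazard_rate M Z j = \<P>(\<omega> in M. Z \<omega> = j) / \<P>(\<omega> in M. Z \<omega> \<ge> j)"

end

theory Submission
  imports Defs
begin

text \<open>
  An observation \<open>x t\<close> lies between the record equal to the running maximum at \<open>t\<close> and the next
  one, and the first \<open>n > j + k\<close> records of an unbounded sequence contain all records up to
  \<open>j + k\<close>. Hence, if \<open>T\<close> is the number of observations before the first one exceeding \<open>j + k\<close>,
  then \<open>V\<close> counts the \<open>t \<le> T\<close> with \<open>x t = j\<close> and \<open>N - 1\<close> counts those with \<open>x t \<ge> j\<close>. As
  \<open>T \<rightarrow> \<infinity>\<close> with \<open>k\<close>, the strong law of large numbers for indicators, obtained from Hoeffding's
  inequality and Borel-Cantelli, gives the almost sure limit; the estimator lies in \<open>[0, 1]\<close>, so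
  dominated convergence gives the limit of the mean squared error.
\<close>

section \<open>Record times and running maxima on an arbitrary path\<close>

lemma record_time_pos: "1 \<le> record_time x m"
proof (induction m rule: record_time.induct[where ?a0.0 = x])
  case (3 x m)
  then show ?case
    by (auto simp: Let_def intro: LeastI2_ex order.trans[OF _ less_imp_le])
qed auto

lemma record_time_Suc:
  assumes "1 \<le> m"
  shows "record_time x (Suc m) =
    (if \<exists>i>record_time x m. x i > x (record_time x m)
     then LEAST i. i > record_time x m \<and> x i > x (record_time x m) else record_time x m)"
  using assms by (cases m) (auto simp: Let_def)

lemma record_time_le_Suc:
  assumes "1 \<le> m"
  shows "record_time x m \<le> record_time x (Suc m)"
  unfolding record_time_Suc[OF assms] by (auto intro: LeastI2_ex less_imp_le)

lemma between_records_le: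
  assumes "1 \<le> m" "record_time x m < t" "t < record_time x (Suc m)"
  shows "x t \<le> x (record_time x m)"
  using assms(2,3) not_less_Least unfolding record_time_Suc[OF assms(1)]
  by (fastforce split: if_splits)

text \<open>A repeated record time, the convention for paths whose records stop, is the first
  alternative. Keeping it as a case lets the comparisons below hold on every path.\<close>

lemma record_time_Suc_cases:
  assumes "1 \<le> m"
  shows "record_time x (Suc m) = record_time x m \<or>
    record_time x m < record_time x (Suc m) \<and> x (record_time x m) < x (record_time x (Suc m))"
proof (cases "\<exists>i>record_time x m. x i > x (record_time x m)")
  case True
  then show ?thesis
    using LeastI_ex[OF True] unfolding record_time_Suc[OF assms] by simp
next
  case False
  then show ?thesis
    unfolding record_time_Suc[OF assms] by meson
qed

text \<open>By induction over records: earlier times are covered by the hypothesis, times strictly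
  between two records by the minimality of the next record time, and a new record exceeds the old
  one.\<close>

lemma upto_record_le:
  assumes "1 \<le> m" "1 \<le> t" "t \<le> record_time x m"
  shows "x t \<le> x (record_time x m)"
  using assms
proof (induction m arbitrary: t rule: dec_induct)
  case base
  then show ?case by simp
next
  case (step m)
  consider "t \<le> record_time x m" | "record_time x m < t" "t < record_time x (Suc m)"
    | "t = record_time x (Suc m)"
    using step.prems by linarith
  then have "x t \<le> x (record_time x m) \<or> t = record_time x (Suc m)"
    using step.IH step.prems between_records_le[OF step.hyps(1)] by cases auto
  then show ?case
    using record_time_Suc_cases[OF step.hyps(1), of x] by auto
qed

lemma before_next_record_le:
  assumes "1 \<le> m" "1 \<le> t" "t < record_time x (Suc m)"
  shows "x t \<le> x (record_time x m)"
  using assms upto_record_le[OF assms(1,2)] between_records_le[OF assms(1) _ assms(3)]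
  by (meson linorder_le_less_linear)

text \<open>This is the bridge from records to running maxima: the current record can be read off
  from \<open>running_max\<close> without mentioning its index.\<close>

lemma running_max_record:
  assumes "1 \<le> m" "record_time x m \<le> t" "t < record_time x (Suc m)"
  shows "running_max x t = x (record_time x m)"
  unfolding running_max_def
proof (rule Max_eqI)
  show "x (record_time x m) \<in> x ` {1..t}"
    using record_time_pos[of x m] assms(2) by auto
qed (use before_next_record_le[OF assms(1)] assms(3) in auto)

lemma le_running_max: "1 \<le> t \<Longrightarrow> x t \<le> running_max x t"
  by (auto simp: running_max_def)

lemma running_max_le_iff: "1 \<le> t \<Longrightarrow> running_max x t \<le> a \<longleftrightarrow> (\<forall>i\<in>{1..t}. x i \<le> a)"
  by (auto simp: running_max_def)

section \<open>Near-records and the statistic A as counts of times\<close>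

lemma near_record_times_eq:
  assumes "1 \<le> m"
  shows "near_record_times k x m =
    {t. record_time x m < t \<and> t < record_time x (Suc m) \<and> record_value x m \<le> x t + k}"
proof -
  \<comment> \<open>Strictly between two records the running maximum at \<open>t - 1\<close> is the
    current record, and \<open>x t\<close> cannot exceed it. Only the lower bound remains, stated
    with \<open>k\<close> added on the right to avoid truncated subtraction.\<close>
  have "near_record k x t \<longleftrightarrow> record_value x m \<le> x t + k"
    if "record_time x m < t" "t < record_time x (Suc m)" for t
    using running_max_record[OF assms, of x "t - 1"] between_records_le[OF assms that]
      record_time_pos[of x m] that
    by (auto simp: near_record_def record_value_def)
  then show ?thesis
    by (auto simp: near_record_times_def)
qed

text \<open>The sorted list enumerates the finite set of near-record times bijectively, so the index
  \<open>r\<close>, shifted by one, can be traded for the time itself.\<close>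

lemma sum_near_record_value:
  "(\<Sum>r=1..near_record_count k x m. f (near_record_value k x m r)) =
    (\<Sum>t\<in>near_record_times k x m. f (x t))"
proof -
  let ?S = "near_record_times k x m"
  let ?xs = "sorted_list_of_set ?S"
  have "finite ?S"
    by (rule finite_subset[of _ "{..record_time x (m + 1)}"]) (auto simp: near_record_times_def)
  then have "bij_betw ((!) ?xs) {..<card ?S} ?S"
    by (intro bij_betw_nth) auto
  then have "(\<Sum>t\<in>?S. f (x t)) = (\<Sum>i<card ?S. f (x (?xs ! i)))"
    by (rule sum.reindex_bij_betw[symmetric])
  also have "\<dots> = (\<Sum>r=1..card ?S. f (x (?xs ! (r - 1))))"
    by (rule sum.reindex_bij_witness[of _ "\<lambda>r. r - 1" Suc]) auto
  finally show ?thesis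
    by (simp add: near_record_value_def near_record_count_def)
qed

text \<open>
  No growth assumption on \<open>x\<close> is made here: measurability of the estimator is needed on the whole
  space, including the null event on which the records stop.
\<close>

lemma A_stat_eq:
  assumes "l \<le> k"
  shows "A_stat k n x l m = (\<Sum>i=1..n. of_bool (l = 0 \<and> record_value x i = m) +
    card {t. record_time x i < t \<and> t < record_time x (Suc i) \<and> record_value x i = m + l \<and> x t = m})"
proof -
  have "(\<Sum>r=1..near_record_count k x i.
      of_bool (record_value x i = m + l \<and> near_record_value k x i r = m)) =
    card {t. record_time x i < t \<and> t < record_time x (Suc i) \<and> record_value x i = m + l \<and> x t = m}"
    (is "?L = card ?R") if "1 \<le> i" for i
  proof -
    have "?L = (\<Sum>t\<in>near_record_times k x i. of_bool (record_value x i = m + l \<and> x t = m))"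
      by (rule sum_near_record_value)
    also have "\<dots> = card {t \<in> near_record_times k x i. record_value x i = m + l \<and> x t = m}"
      using finite_subset[of "near_record_times k x i" "{..record_time x (i + 1)}"]
      by (subst sum_of_bool_eq) (auto simp: near_record_times_def Int_def)
    also have "{t \<in> near_record_times k x i. record_value x i = m + l \<and> x t = m} = ?R"
      using assms by (auto simp: near_record_times_eq[OF that])
    finally show ?thesis .
  qed
  then show ?thesis
    unfolding A_stat_def by (cases "l = 0") simp_all
qed

section \<open>Counting formulas on unbounded paths\<close>

context
  fixes x :: "nat \<Rightarrow> nat"
  assumes unbounded: "\<And>a. \<exists>t\<ge>1. a < x t"
begin

lemma record_time_less_Suc:
  assumes "1 \<le> m"
  shows "record_time x m < record_time x (Suc m)"
proof -
  obtain t where t: "1 \<le> t" "x (record_time x m) < x t"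
    using unbounded by blast
  then have "record_time x m < t"
    using upto_record_le[OF assms t(1)] by (meson leD leI)
  then show ?thesis
    using t LeastI_ex[of "\<lambda>i. record_time x m < i \<and> x (record_time x m) < x i"]
    by (auto simp: record_time_Suc[OF assms])
qed

lemma record_time_Suc_le:
  assumes "1 \<le> i" "i < i'"
  shows "record_time x (Suc i) \<le> record_time x i'"
proof -
  have "Suc i \<le> i'" using assms by simp
  then show ?thesis
    by (induction i' rule: dec_induct) (use assms record_time_le_Suc in \<open>auto intro: order.trans\<close>)
qed

text \<open>Records of an unbounded path are strictly increasing naturals, the first being at least
  0. Hence more than \<open>a\<close> records include every record of value at most
  \<open>a\<close>.\<close>

lemma le_Suc_record_value:
  assumes "1 \<le> m"
  shows "m \<le> Suc (record_value x m)"
  using assms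
proof (induction m rule: dec_induct)
  case (step m)
  then show ?case
    using record_time_Suc_cases[of m x] record_time_less_Suc[of m] by (simp add: record_value_def)
qed simp

text \<open>With \<open>record_time_Suc_le\<close>, the half-open spans from one record time to the
  next partition the positive times. Passing from \<open>t\<close> to \<open>Suc t\<close> either
  stays in the span or starts the next one.\<close>

lemma ex_record_span:
  assumes "1 \<le> t"
  shows "\<exists>m\<ge>1. record_time x m \<le> t \<and> t < record_time x (Suc m)"
  using assms
proof (induction t rule: dec_induct)
  case base
  then show ?case
    using record_time_less_Suc[of 1] by (intro exI[of _ 1]) simp
next
  case (step t)
  then obtain m where m: "1 \<le> m" "record_time x m \<le> t" "t < record_time x (Suc m)"
    by auto
  show ?case
  proof (cases "Suc t < record_time x (Suc m)")
    case True
    then show ?thesis using m by (intro exI[of _ m]) simp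
  next
    case False
    then have "record_time x (Suc m) = Suc t" using m by simp
    then show ?thesis
      using record_time_less_Suc[of "Suc m"] by (intro exI[of _ "Suc m"]) simp
  qed
qed

lemma A_stat_card:
  assumes "l \<le> k" "m + l < n"
  shows "A_stat k n x l m = card {t. 1 \<le> t \<and> x t = m \<and> running_max x t = m + l}"
proof -
  let ?B = "\<lambda>i. {t. record_time x i \<le> t \<and> t < record_time x (Suc i) \<and> record_value x i = m + l \<and> x t = m}"
  let ?C = "\<lambda>i. {t. record_time x i < t \<and> t < record_time x (Suc i) \<and> record_value x i = m + l \<and> x t = m}"
  have fin: "finite (?B i)" "finite (?C i)" for i
    by (intro finite_subset[OF _ finite_atMost[of "record_time x (Suc i)"]] subsetI; simp)+
  \<comment> \<open>The record opening the span has value \<open>m + l\<close>, so it satisfies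
    \<open>x t = m\<close> exactly when \<open>l = 0\<close>. The extra indicator in the definition
    for \<open>l = 0\<close> thus adds the left endpoint.\<close>
  have "of_bool (l = 0 \<and> record_value x i = m) + card (?C i) = card (?B i)" if "1 \<le> i" for i
  proof (cases "l = 0 \<and> record_value x i = m")
    case True
    then have "?B i = insert (record_time x i) (?C i)"
      using record_time_less_Suc[OF that] by (auto simp: record_value_def)
    then show ?thesis
      using True fin(2)[of i] by simp
  next
    case False
    then have "?B i = ?C i"
      by (auto simp: record_value_def le_less)
    then show ?thesis
      using False by simp
  qed
  then have "A_stat k n x l m = (\<Sum>i\<in>{1..n}. card (?B i))"
    unfolding A_stat_eq[OF assms(1)] by (intro sum.cong) auto
  also have "\<dots> = card (\<Union>i\<in>{1..n}. ?B i)"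
  proof (rule card_UN_disjoint[symmetric])
    have "?B i \<inter> ?B i' = {}" if "1 \<le> i" "i < i'" for i i'
      using record_time_Suc_le[OF that] by auto
    then show "\<forall>i\<in>{1..n}. \<forall>i'\<in>{1..n}. i \<noteq> i' \<longrightarrow> ?B i \<inter> ?B i' = {}"
      by (intro ballI impI) (metis (no_types, lifting) Int_commute atLeastAtMost_iff nat_neq_iff)
  qed (use fin in auto)
  also have "(\<Union>i\<in>{1..n}. ?B i) = {t. 1 \<le> t \<and> x t = m \<and> running_max x t = m + l}"
  proof (intro equalityI subsetI)
    fix t assume "t \<in> (\<Union>i\<in>{1..n}. ?B i)"
    then obtain i where i: "1 \<le> i" "t \<in> ?B i" by auto
    then show "t \<in> {t. 1 \<le> t \<and> x t = m \<and> running_max x t = m + l}"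
      using running_max_record[OF i(1), of x t] record_time_pos[of x i]
      by (auto simp: record_value_def)
  next
    fix t assume "t \<in> {t. 1 \<le> t \<and> x t = m \<and> running_max x t = m + l}"
    then have t: "1 \<le> t" "x t = m" "running_max x t = m + l" by auto
    obtain i where i: "1 \<le> i" "record_time x i \<le> t" "t < record_time x (Suc i)"
      using ex_record_span[OF t(1)] by blast
    then have v: "record_value x i = m + l"
      using running_max_record t(3) by (simp add: record_value_def)
    \<comment> \<open>The index is at most \<open>m + l + 1\<close>, which is at most
      \<open>n\<close>, so the span of \<open>t\<close> is among those summed over.\<close>
    then have "i \<le> n"
      using le_Suc_record_value[OF i(1)] assms(2) by simp
    then show "t \<in> (\<Union>i\<in>{1..n}. ?B i)"
      using i v t(2) by auto
  qed
  finally show ?thesis .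
qed

lemma finite_running_max_le: "finite {t. 1 \<le> t \<and> running_max x t \<le> a}"
proof -
  obtain s where s: "1 \<le> s" "a < x s" using unbounded by blast
  have "{t. 1 \<le> t \<and> running_max x t \<le> a} \<subseteq> {..s}"
  proof
    fix t assume "t \<in> {t. 1 \<le> t \<and> running_max x t \<le> a}"
    then show "t \<in> {..s}"
      using s running_max_le_iff[of t x a] by (cases "s \<le> t") (auto dest: bspec[of _ _ s])
  qed
  then show ?thesis by (rule finite_subset) simp
qed

text \<open>The summands sort the times by the value of the running maximum. It is at least
  \<open>x t = m\<close>, so its excess over \<open>m\<close> is a natural number and gives the
  index \<open>i\<close>.\<close>

lemma V_stat_card:
  assumes "l \<le> k" "m + l < n"
  shows "V_stat k n x l m = card {t. 1 \<le> t \<and> x t = m \<and> running_max x t \<le> m + l}"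
proof -
  let ?B = "\<lambda>i. {t. 1 \<le> t \<and> x t = m \<and> running_max x t = m + i}"
  have "V_stat k n x l m = (\<Sum>i\<in>{0..l}. card (?B i))"
    unfolding V_stat_def using assms by (intro sum.cong A_stat_card) auto
  also have "\<dots> = card (\<Union>i\<in>{0..l}. ?B i)"
  proof (rule card_UN_disjoint[symmetric])
    show "\<forall>i\<in>{0..l}. finite (?B i)"
      by (intro ballI finite_subset[OF _ finite_running_max_le[of "m + l"]]) auto
  qed auto
  also have "(\<Union>i\<in>{0..l}. ?B i) = {t. 1 \<le> t \<and> x t = m \<and> running_max x t \<le> m + l}"
  proof -
    have "\<exists>i\<in>{0..l}. running_max x t = m + i"
      if "1 \<le> t" "x t = m" "running_max x t \<le> m + l" for t
      using that le_running_max[of t x] by (intro bexI[of _ "running_max x t - m"]) auto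
    then show ?thesis by fastforce
  qed
  finally show ?thesis .
qed

text \<open>In the summand with index \<open>i\<close> the bound on the running maximum is
  \<open>(j + i) + (k - i) = j + k\<close>. All summands therefore share one time window and differ
  only in the value \<open>x t = j + i\<close>.\<close>

lemma N_stat_card:
  assumes "j + k < n"
  shows "N_stat k n x k j = Suc (card {t. 1 \<le> t \<and> j \<le> x t \<and> running_max x t \<le> j + k})"
proof -
  let ?B = "\<lambda>i. {t. 1 \<le> t \<and> x t = j + i \<and> running_max x t \<le> j + k}"
  have "N_stat k n x k j = Suc (\<Sum>i\<in>{0..k}. card (?B i))"
    unfolding N_stat_def using assms by (simp add: V_stat_card)
  also have "(\<Sum>i\<in>{0..k}. card (?B i)) = card (\<Union>i\<in>{0..k}. ?B i)"
  proof (rule card_UN_disjoint[symmetric])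
    show "\<forall>i\<in>{0..k}. finite (?B i)"
      by (intro ballI finite_subset[OF _ finite_running_max_le[of "j + k"]]) auto
  qed auto
  also have "(\<Union>i\<in>{0..k}. ?B i) = {t. 1 \<le> t \<and> j \<le> x t \<and> running_max x t \<le> j + k}"
  proof -
    have "\<exists>i\<in>{0..k}. x t = j + i"
      if "1 \<le> t" "j \<le> x t" "running_max x t \<le> j + k" for t
      using that le_running_max[of t x] by (intro bexI[of _ "x t - j"]) auto
    then show ?thesis by fastforce
  qed
  finally show ?thesis .
qed

text \<open>The running maximum is at most \<open>a\<close> exactly before the first observation
  above \<open>a\<close>; \<open>Suc T\<close> is the time of that observation, and \<open>T\<close>
  may be 0.\<close>

lemma running_max_le_interval:
  obtains T where "{t. 1 \<le> t \<and> running_max x t \<le> a} = {1..T}" "a < x (Suc T)"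
proof -
  define s where "s = (LEAST t. 1 \<le> t \<and> a < x t)"
  have s: "1 \<le> s" "a < x s"
    using LeastI_ex[of "\<lambda>t. 1 \<le> t \<and> a < x t"] unbounded unfolding s_def by blast+
  have le: "x t \<le> a" if "1 \<le> t" "t < s" for t
    using not_less_Least[of t "\<lambda>t. 1 \<le> t \<and> a < x t"] that unfolding s_def by auto
  have "running_max x t \<le> a \<longleftrightarrow> t < s" if "1 \<le> t" for t
    unfolding running_max_le_iff[OF that] using s le by (meson atLeastAtMost_iff leD le_less_trans not_le)
  then have "{t. 1 \<le> t \<and> running_max x t \<le> a} = {1..s - 1}"
    using s by auto
  then show ?thesis
    using that[of "s - 1"] s by simp
qed

section \<open>Passage to the limit along one path\<close>

lemma hazard_estimator_tendsto:
  fixes n :: "nat \<Rightarrow> nat" and p q :: real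
  assumes n: "\<And>k. 1 \<le> k \<Longrightarrow> j + k < n k"
    and p: "(\<lambda>T. real (card {t\<in>{1..T}. x t = j}) / real T) \<longlonglongrightarrow> p"
    and q: "(\<lambda>T. real (card {t\<in>{1..T}. j \<le> x t}) / real T) \<longlonglongrightarrow> q"
    and "q \<noteq> 0"
  shows "(\<lambda>k. hazard_estimator k (n k) x j) \<longlonglongrightarrow> p / q"
proof -
  have "\<forall>k. \<exists>T. {t. 1 \<le> t \<and> running_max x t \<le> j + k} = {1..T} \<and> j + k < x (Suc T)"
    by (intro allI) (rule running_max_le_interval, blast)
  then obtain T where T: "\<And>k. {t. 1 \<le> t \<and> running_max x t \<le> j + k} = {1..T k}"
      "\<And>k. j + k < x (Suc (T k))"
    unfolding choice_iff by blast
  have "filterlim T at_top sequentially"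
    unfolding filterlim_at_top
  proof
    fix C
    \<comment> \<open>If \<open>Suc (T k) \<le> C\<close>, the observation at
      \<open>Suc (T k)\<close> would be at most this maximum, hence at most \<open>k\<close>,
      although it exceeds \<open>j + k\<close>.\<close>
    have "C \<le> T k" if "k \<ge> Max (x ` {..C})" for k
    proof (rule ccontr)
      assume "\<not> C \<le> T k"
      then have "x (Suc (T k)) \<le> Max (x ` {..C})" by simp
      then show False using T(2)[of k] that by simp
    qed
    then show "\<forall>\<^sub>F k in sequentially. C \<le> T k"
      unfolding eventually_sequentially by blast
  qed
  \<comment> \<open>Numerator and denominator are divided by \<open>T k\<close>; the summand 1 of
    \<open>N_stat\<close> becomes the vanishing term \<open>1 / T k\<close>.\<close>
  have est: "hazard_estimator k (n k) x j =
      (real (card {t\<in>{1..T k}. x t = j}) / real (T k)) /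
      (1 / real (T k) + real (card {t\<in>{1..T k}. j \<le> x t}) / real (T k))"
    if "1 \<le> k" "1 \<le> T k" for k
  proof -
    have "{t\<in>{1..T k}. P t} = {t. 1 \<le> t \<and> P t \<and> running_max x t \<le> j + k}" for P
      using T(1)[of k] by blast
    then have "V_stat k (n k) x k j = card {t\<in>{1..T k}. x t = j}"
      and "N_stat k (n k) x k j = Suc (card {t\<in>{1..T k}. j \<le> x t})"
      using V_stat_card[of k k j "n k"] N_stat_card[of j k "n k"] n[OF that(1)] by simp_all
    then show ?thesis
      using that(2) by (simp add: hazard_estimator_def flip: add_divide_distrib)
  qed
  have "((\<lambda>T. (real (card {t\<in>{1..T}. x t = j}) / real T) /
      (1 / real T + real (card {t\<in>{1..T}. j \<le> x t}) / real T)) \<longlongrightarrow> p / (0 + q)) sequentially"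
    using \<open>q \<noteq> 0\<close> by (intro tendsto_divide tendsto_add p q lim_1_over_n) auto
  from filterlim_compose[OF this \<open>filterlim T at_top sequentially\<close>]
  have "(\<lambda>k. (real (card {t\<in>{1..T k}. x t = j}) / real (T k)) /
      (1 / real (T k) + real (card {t\<in>{1..T k}. j \<le> x t}) / real (T k))) \<longlonglongrightarrow> p / q"
    by simp
  moreover have "\<forall>\<^sub>F k in sequentially. 1 \<le> k \<and> 1 \<le> T k"
    using \<open>filterlim T at_top sequentially\<close> eventually_ge_at_top[of 1]
    unfolding filterlim_at_top by (intro eventually_conj) blast+
  ultimately show ?thesis
    by (rule Lim_transform_eventually[OF _ eventually_mono]) (simp add: est)
qed

end

section \<open>Bounds and measurability of the estimator\<close>

lemma hazard_estimator_bounds: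
  "0 \<le> hazard_estimator k n x j" "hazard_estimator k n x j \<le> 1"
proof -
  \<comment> \<open>The summand with \<open>i = 0\<close> in \<open>N_stat\<close> is this very
    \<open>V_stat\<close>.\<close>
  have "V_stat k n x k j \<le> N_stat k n x k j"
    unfolding N_stat_def by (simp add: sum.atLeast_Suc_atMost)
  then show "0 \<le> hazard_estimator k n x j" "hazard_estimator k n x j \<le> 1"
    by (auto simp: hazard_estimator_def divide_le_eq_1)
qed

lemma pred_less_count_space:
  fixes f g :: "'a \<Rightarrow> nat"
  assumes "f \<in> M \<rightarrow>\<^sub>M count_space UNIV" and g: "g \<in> M \<rightarrow>\<^sub>M count_space UNIV"
  shows "Measurable.pred M (\<lambda>\<omega>. f \<omega> < g \<omega>)"
proof (rule measurable_compose_countable[OF _ g])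
  show "Measurable.pred M (\<lambda>\<omega>. f \<omega> < i)" for i
    by (rule measurable_compose[OF assms(1)]) simp
qed

lemma measurable_record_time_value:
  fixes X :: "nat \<Rightarrow> 'a \<Rightarrow> nat"
  assumes X: "\<And>i. 1 \<le> i \<Longrightarrow> X i \<in> M \<rightarrow>\<^sub>M count_space UNIV"
  shows "(\<lambda>\<omega>. record_time (\<lambda>i. X i \<omega>) m) \<in> M \<rightarrow>\<^sub>M count_space UNIV"
    and "(\<lambda>\<omega>. record_value (\<lambda>i. X i \<omega>) m) \<in> M \<rightarrow>\<^sub>M count_space UNIV"
proof -
  note [measurable (raw)] = pred_less_count_space
  \<comment> \<open>nothing is assumed about \<open>X 0\<close>, so the countable composition goes through \<open>max 1\<close>\<close>
  have X': "(\<lambda>\<omega>. X (max 1 i) \<omega>) \<in> M \<rightarrow>\<^sub>M count_space UNIV" for i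
    by (rule X) simp
  have val: "(\<lambda>\<omega>. record_value (\<lambda>i. X i \<omega>) m) \<in> M \<rightarrow>\<^sub>M count_space UNIV"
    if "(\<lambda>\<omega>. record_time (\<lambda>i. X i \<omega>) m) \<in> M \<rightarrow>\<^sub>M count_space UNIV" for m
    using measurable_compose_countable[where f = "\<lambda>i. X (max 1 i)", OF X' that]
    by (simp add: record_value_def max_absorb2 record_time_pos del: One_nat_def)
  show time: "(\<lambda>\<omega>. record_time (\<lambda>i. X i \<omega>) m) \<in> M \<rightarrow>\<^sub>M count_space UNIV" for m
  proof (induction m)
    case (Suc m)
    show ?case
    proof (cases "1 \<le> m")
      case True
      note [measurable] = Suc val[OF Suc]
      \<comment> \<open>At \<open>i = 0\<close> the predicate is false because no time is below 0,
        so \<open>X 0\<close> is never consulted.\<close>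
      have [measurable]: "Measurable.pred M (\<lambda>\<omega>. record_time (\<lambda>i. X i \<omega>) m < i \<and>
          record_value (\<lambda>i. X i \<omega>) m < X i \<omega>)" for i
      proof (cases "1 \<le> i")
        case True
        note [measurable] = X[OF True]
        show ?thesis by measurable
      next
        case False
        then show ?thesis by simp
      qed
      have "record_time x (Suc m) =
          (if \<exists>i. record_time x m < i \<and> record_value x m < x i
           then LEAST i. record_time x m < i \<and> record_value x m < x i else record_time x m)" for x
        unfolding record_time_Suc[OF True] record_value_def by simp
      then show ?thesis by simp
    next
      case False
      then have "m = 0" by simp
      then show ?thesis by simp
    qed
  qed simp
  show "(\<lambda>\<omega>. record_value (\<lambda>i. X i \<omega>) m) \<in> M \<rightarrow>\<^sub>M count_space UNIV"
    by (rule val[OF time])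
qed

lemma measurable_hazard_estimator:
  fixes X :: "nat \<Rightarrow> 'a \<Rightarrow> nat"
  assumes X: "\<And>i. 1 \<le> i \<Longrightarrow> X i \<in> M \<rightarrow>\<^sub>M count_space UNIV"
  shows "(\<lambda>\<omega>. hazard_estimator k n (\<lambda>i. X i \<omega>) j) \<in> borel_measurable M"
proof -
  have time: "(\<lambda>\<omega>. record_time (\<lambda>i. X i \<omega>) i) \<in> M \<rightarrow>\<^sub>M count_space UNIV"
    and val: "(\<lambda>\<omega>. record_value (\<lambda>i. X i \<omega>) i) \<in> M \<rightarrow>\<^sub>M count_space UNIV" for i
    using measurable_record_time_value[of X M i] X by blast+
  have near: "Measurable.pred M (\<lambda>\<omega>. record_time (\<lambda>i. X i \<omega>) i < t \<and>
      t < record_time (\<lambda>i. X i \<omega>) (Suc i) \<and> record_value (\<lambda>i. X i \<omega>) i = a \<and> X t \<omega> = m)" for i t a m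
  proof (cases "1 \<le> t")
    case True
    note [measurable] = X[OF True] time val
    note [measurable (raw)] = pred_less_count_space
    show ?thesis by measurable
  next
    case False
    then show ?thesis by simp
  qed
  have A: "(\<lambda>\<omega>. real (A_stat k n (\<lambda>i. X i \<omega>) l m)) \<in> borel_measurable M" if "l \<le> k" for l m
  proof -
    have "(\<lambda>\<omega>. of_bool (l = 0 \<and> record_value (\<lambda>i. X i \<omega>) i = m) :: real) \<in> borel_measurable M" for i
      by (rule measurable_compose[OF val]) simp_all
    \<comment> \<open>The cardinality of a random set of naturals is measurable once each membership
      event is, and \<open>near\<close> supplies these events.\<close>
    moreover have "(\<lambda>\<omega>. real (card {t. record_time (\<lambda>i. X i \<omega>) i < t \<and> t < record_time (\<lambda>i. X i \<omega>) (Suc i) \<and>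
        record_value (\<lambda>i. X i \<omega>) i = m + l \<and> X t \<omega> = m})) \<in> borel_measurable M" for i
      by (rule measurable_compose[OF measurable_card], unfold mem_Collect_eq)
         (rule near[unfolded pred_def], simp)
    ultimately show ?thesis
      unfolding A_stat_eq[OF that] of_nat_sum of_nat_add of_nat_of_bool
      by (intro borel_measurable_sum borel_measurable_add)
  qed
  have V: "(\<lambda>\<omega>. real (V_stat k n (\<lambda>i. X i \<omega>) l m)) \<in> borel_measurable M" if "l \<le> k" for l m
    unfolding V_stat_def of_nat_sum using that by (intro borel_measurable_sum A) auto
  have "(\<lambda>\<omega>. real (N_stat k n (\<lambda>i. X i \<omega>) k j)) \<in> borel_measurable M"
    unfolding N_stat_def of_nat_sum of_nat_add
    by (intro borel_measurable_sum borel_measurable_add V) auto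
  then show ?thesis
    unfolding hazard_estimator_def by (intro borel_measurable_divide V) auto
qed

section \<open>Strong law of large numbers for empirical frequencies\<close>

lemma (in prob_space) AE_empirical_frequency_tendsto:
  fixes X :: "nat \<Rightarrow> 'a \<Rightarrow> 'b"
  assumes indep: "indep_vars (\<lambda>_. N) X {1..}"
    and ident: "\<And>i. 1 \<le> i \<Longrightarrow> distr M N (X i) = distr M N (X 1)"
    and A: "A \<in> sets N"
  shows "AE \<omega> in M. (\<lambda>n. real (card {t\<in>{1..n}. X t \<omega> \<in> A}) / real n) \<longlonglongrightarrow> \<P>(\<omega> in M. X 1 \<omega> \<in> A)"
proof -
  let ?p = "\<P>(\<omega> in M. X 1 \<omega> \<in> A)"
  let ?f = "\<lambda>i \<omega>. indicator A (X i \<omega>) :: real"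
  have X: "X i \<in> M \<rightarrow>\<^sub>M N" if "1 \<le> i" for i
    using indep that unfolding indep_vars_def by auto
  have freq: "real (card {t\<in>{1..n}. X t \<omega> \<in> A}) = (\<Sum>i\<in>{1..n}. ?f i \<omega>)" for n \<omega>
    by (simp add: indicator_def Int_def flip: of_bool_def)
  have f [measurable]: "?f i \<in> borel_measurable M" if "1 \<le> i" for i
    using X[OF that] A by simp
  have bound: "prob {\<omega>\<in>space M. \<bar>(\<Sum>i\<in>{1..n}. ?f i \<omega>) / n - ?p\<bar> \<ge> \<epsilon>} \<le> 2 * exp (-2 * real n * \<epsilon>\<^sup>2)"
    if "1 \<le> n" "0 \<le> \<epsilon>" for n and \<epsilon> :: real
  proof -
    have "expectation (?f 1) = ?p"
    proof -
      have "expectation (?f 1) = expectation (indicator {\<omega>\<in>space M. X 1 \<omega> \<in> A})"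
        by (intro Bochner_Integration.integral_cong) (auto simp: indicator_def)
      then show ?thesis
        using X[of 1] A by (simp add: measurable_sets_Collect)
    qed
    \<comment> \<open>The indicators take values in an interval of length 1, so no further constant
      enters the exponent.\<close>
    interpret Hoeffding_ineq_iid M "{1..n}" ?f "?f 1" 0 1 ?p
    proof unfold_locales
      have "indep_vars (\<lambda>_. N) X {1..n}"
        by (rule indep_vars_subset[OF indep]) auto
      then show "indep_vars (\<lambda>_. borel) ?f {1..n}"
        by (rule indep_vars_compose2[where Y = "\<lambda>_. indicator A"]) (rule borel_measurable_indicator[OF A])
    next
      fix i assume "i \<in> {1..n}"
      then have i: "1 \<le> i" by simp
      have "distr M borel (?f i) = distr (distr M N (X i)) borel (indicator A)" if "1 \<le> i" for i
        using X[OF that] A by (subst distr_distr) (auto simp: comp_def)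
      from this[OF i] this[of 1] show "distr M borel (?f i) = distr M borel (?f 1)"
        using ident[OF i] by simp
    qed (use f[of 1] \<open>expectation (?f 1) = ?p\<close> in \<open>auto simp: indicator_def\<close>)
    show ?thesis
      using Hoeffding_ineq_abs_ge'[OF that(2)] that(1) by simp
  qed
  have "AE \<omega> in M. \<forall>\<^sub>F n in sequentially. \<bar>(\<Sum>i\<in>{1..n}. ?f i \<omega>) / n - ?p\<bar> < \<epsilon>"
    if "0 < \<epsilon>" for \<epsilon> :: real
  proof -
    let ?B = "\<lambda>n. {\<omega>\<in>space M. \<bar>(\<Sum>i\<in>{1..n}. ?f i \<omega>) / real n - ?p\<bar> \<ge> \<epsilon>}"
    have B: "?B n \<in> sets M" for n
    proof -
      have [measurable]: "(\<lambda>\<omega>. \<Sum>i\<in>{1..n}. ?f i \<omega>) \<in> borel_measurable M"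
        by (intro borel_measurable_sum f) simp
      show ?thesis by measurable
    qed
    \<comment> \<open>For fixed \<open>\<epsilon>\<close> the Hoeffding bound is geometric in
      \<open>n\<close>, with ratio below 1, as Borel-Cantelli requires.\<close>
    have "summable (\<lambda>n. 2 * exp (-2 * \<epsilon>\<^sup>2) ^ n)"
      using that by (intro summable_mult summable_geometric) simp
    then have "summable (\<lambda>n. prob (?B n))"
    proof (rule summable_comparison_test_ev[rotated])
      show "\<forall>\<^sub>F n in sequentially. norm (prob (?B n)) \<le> 2 * exp (-2 * \<epsilon>\<^sup>2) ^ n"
        using eventually_ge_at_top[of 1]
      proof eventually_elim
        case (elim n)
        then show ?case
          using bound[of n \<epsilon>] that by (simp add: exp_of_nat_mult[symmetric] mult_ac)
      qed
    qed
    then have "AE \<omega> in M. \<forall>\<^sub>F n in sequentially. \<omega> \<in> space M - ?B n"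
      by (intro borel_cantelli_AE1 B) (auto simp: less_top[symmetric])
    then show ?thesis
      by eventually_elim (auto elim!: eventually_mono)
  qed
  \<comment> \<open>Restricting to the tolerances \<open>1 / (m + 1)\<close> leaves countably many
    null sets, so one event of probability 1 serves them all.\<close>
  then have "AE \<omega> in M. \<forall>m. \<forall>\<^sub>F n in sequentially.
      \<bar>(\<Sum>i\<in>{1..n}. ?f i \<omega>) / n - ?p\<bar> < inverse (real (Suc m))"
    unfolding AE_all_countable by auto
  then show ?thesis
  proof eventually_elim
    case (elim \<omega>)
    show ?case
      unfolding freq
    proof (rule tendstoI)
      fix e :: real assume "0 < e"
      then obtain m where "inverse (real (Suc m)) < e"
        using reals_Archimedean by blast
      then show "\<forall>\<^sub>F n in sequentially. dist ((\<Sum>i\<in>{1..n}. ?f i \<omega>) / real n) ?p < e"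
        using elim[rule_format, of m] by (auto elim!: eventually_mono simp: dist_real_def)
    qed
  qed
qed

section \<open>Almost sure and mean square convergence\<close>

theorem theorem3p9:
  fixes M :: "'a measure" and X :: "nat \<Rightarrow> 'a \<Rightarrow> nat" and j :: nat and n :: "nat \<Rightarrow> nat"
  assumes "prob_space M"
    and "prob_space.indep_vars M (\<lambda>_. count_space UNIV) X {1..}"
    and "\<And>i. i \<ge> 1 \<Longrightarrow> distr M (count_space UNIV) (X i) = distr M (count_space UNIV) (X 1)"
    and "infinite {a. \<P>(\<omega> in M. X 1 \<omega> = a) > 0}"
    and "\<And>k. k \<ge> 1 \<Longrightarrow> n k > j + k"
  shows "(AE \<omega> in M. (\<lambda>k. hazard_estimator k (n k) (\<lambda>i. X i \<omega>) j) \<longlonglongrightarrow> hazard_rate M (X 1) j)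
    \<and> (\<forall>k. integrable M
          (\<lambda>\<omega>. (hazard_estimator k (n k) (\<lambda>i. X i \<omega>) j - hazard_rate M (X 1) j)\<^sup>2))
    \<and> (\<lambda>k. prob_space.expectation M
          (\<lambda>\<omega>. (hazard_estimator k (n k) (\<lambda>i. X i \<omega>) j - hazard_rate M (X 1) j)\<^sup>2)) \<longlonglongrightarrow> 0"
proof -
  interpret prob_space M by (rule assms(1))
  let ?h = "hazard_rate M (X 1) j"
  let ?E = "\<lambda>k \<omega>. hazard_estimator k (n k) (\<lambda>i. X i \<omega>) j"
  have X: "X i \<in> M \<rightarrow>\<^sub>M count_space UNIV" if "1 \<le> i" for i
    using assms(2) that unfolding indep_vars_def by auto
  have [measurable]: "?E k \<in> borel_measurable M" for k
    by (rule measurable_hazard_estimator) (rule X)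
  have freq: "AE \<omega> in M. (\<lambda>T. real (card {t\<in>{1..T}. X t \<omega> \<in> A}) / real T) \<longlonglongrightarrow> \<P>(\<omega> in M. X 1 \<omega> \<in> A)"
    for A
    by (rule AE_empirical_frequency_tendsto[OF assms(2,3)]) auto
  \<comment> \<open>Infinite support provides an atom at some \<open>b \<ge> a\<close>. Positive
    tails yield both the unboundedness of almost every path and the nonzero denominator of the
    hazard rate.\<close>
  have tail: "0 < \<P>(\<omega> in M. a \<le> X 1 \<omega>)" for a
  proof -
    obtain b where b: "a \<le> b" "0 < \<P>(\<omega> in M. X 1 \<omega> = b)"
      using assms(4) unfolding infinite_nat_iff_unbounded_le by auto
    have "\<P>(\<omega> in M. X 1 \<omega> = b) \<le> \<P>(\<omega> in M. a \<le> X 1 \<omega>)"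
      using b(1) measurable_sets_Collect[OF X[of 1], of "\<lambda>v. a \<le> v"]
      by (intro finite_measure_mono) auto
    then show ?thesis using b(2) by simp
  qed
  \<comment> \<open>On a path bounded by \<open>a\<close> the frequency of \<open>{a<..}\<close> is
    constantly 0, whereas almost surely it tends to a positive tail probability.\<close>
  have unbounded: "AE \<omega> in M. \<forall>a. \<exists>t\<ge>1. a < X t \<omega>"
    unfolding AE_all_countable
  proof
    fix a
    show "AE \<omega> in M. \<exists>t\<ge>1. a < X t \<omega>"
      using freq[of "{a<..}"]
    proof eventually_elim
      case (elim \<omega>)
      show ?case
      proof (rule ccontr)
        assume "\<not> (\<exists>t\<ge>1. a < X t \<omega>)"
        then have "{t\<in>{1..T}. X t \<omega> \<in> {a<..}} = {}" for T by auto
        from elim[unfolded this] have "(\<lambda>T. 0) \<longlonglongrightarrow> \<P>(\<omega> in M. X 1 \<omega> \<in> {a<..})"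
          by simp
        then have "\<P>(\<omega> in M. X 1 \<omega> \<in> {a<..}) = 0"
          by (simp add: LIMSEQ_const_iff)
        then show False
          using tail[of "Suc a"] by (simp add: Suc_le_eq)
      qed
    qed
  qed
  have conv: "AE \<omega> in M. (\<lambda>k. ?E k \<omega>) \<longlonglongrightarrow> ?h"
    using unbounded freq[of "{j}"] freq[of "{j..}"]
  proof eventually_elim
    case (elim \<omega>)
    then show ?case
      unfolding hazard_rate_def using tail[of j] assms(5)
      by (intro hazard_estimator_tendsto) auto
  qed
  \<comment> \<open>A bound uniform in \<open>k\<close> and \<open>\<omega>\<close>; its square
    gives integrability and is the constant majorant for dominated convergence.\<close>
  have "\<bar>?E k \<omega> - ?h\<bar> \<le> 1 + \<bar>?h\<bar>" for k \<omega>
    using hazard_estimator_bounds[of k "n k" "\<lambda>i. X i \<omega>" j] by linarith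
  from power_mono[OF this abs_ge_zero, of _ _ 2]
  have bound: "norm ((?E k \<omega> - ?h)\<^sup>2) \<le> (1 + \<bar>?h\<bar>)\<^sup>2" for k \<omega>
    by simp
  have int: "integrable M (\<lambda>\<omega>. (?E k \<omega> - ?h)\<^sup>2)" for k
    by (rule integrable_const_bound[where B = "(1 + \<bar>?h\<bar>)\<^sup>2"]) (use bound in auto)
  have "(\<lambda>k. expectation (\<lambda>\<omega>. (?E k \<omega> - ?h)\<^sup>2)) \<longlonglongrightarrow> expectation (\<lambda>_. 0)"
  proof (rule integral_dominated_convergence[where w = "\<lambda>_. (1 + \<bar>?h\<bar>)\<^sup>2"])
    show "AE \<omega> in M. (\<lambda>k. (?E k \<omega> - ?h)\<^sup>2) \<longlonglongrightarrow> 0"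
      using conv
    proof eventually_elim
      case (elim \<omega>)
      then have "(\<lambda>k. (?E k \<omega> - ?h)\<^sup>2) \<longlonglongrightarrow> (?h - ?h)\<^sup>2"
        by (intro tendsto_intros)
      then show ?case by simp
    qed
  qed (use bound in auto)
  then show ?thesis
    using conv int by simp
qed

end
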